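(* Let $\lambda$ be a nonzero real number, $k\in\mathbb{Z}$, and let $Y$ be the Bernoulli random variable with probability of success $p$. For every positive integer $n$, $$\mathrm{Bel}_{n,\lambda}^{(k,Y)}(x)=\sum_{m=1}^{n}\frac{(1)_{m,\lambda}}{m^{k-1}}p^{m}{n \brace m}_{\lambda}x^{m}.$$ In particular, $\mathrm{Bel}_{n,\lambda}^{(k,Y)}=\sum_{m=1}^{n}\frac{(1)_{m,\lambda}}{m^{k-1}}p^{m}{n \brace m}_{\lambda}$.
   Context: Degenerate falling factorial: $(x)_{0,\lambda}=1$, $(x)_{n,\lambda}=x(x-\lambda)\cdots(x-(n-1)\lambda)$ for $n\ge1$. Degenerate exponential: $e_\lambda^x(t)=(1+\lambda t)^{x/\lambda}=\sum_{n\ge0}(x)_{n,\lambda}\frac{t^n}{n!}$, $e_\lambda(t)=e_\lambda^1(t)$. For $k\in\mathbb{Z}$, $\mathrm{Ei}_{k,\lambda}(x)=\sum_{n=1}^{\infty}\frac{(1)_{n,\lambda}}{(n-1)!\,n^{k}}x^{n}$. The probabilistic degenerate poly-Bell polynomials $\mathrm{Bel}_{n,\lambda}^{(k,Y)}(x)$ are defined by $\mathrm{Ei}_{k,\lambda}\big(x(E[e_\lambda^Y(t)]-1)\big)=\sum_{n=1}^{\infty}\mathrm{Bel}_{n,\lambda}^{(k,Y)}(x)\frac{t^n}{n!}$ (power series in $t$), with $\mathrm{Bel}_{0,\lambda}^{(k,Y)}(x)=1$, and $\mathrm{Bel}_{n,\lambda}^{(k,Y)}=\mathrm{Bel}_{n,\lambda}^{(k,Y)}(1)$.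 The degenerate Stirling numbers of the second kind are defined by $\frac{1}{k!}(e_\lambda(t)-1)^k=\sum_{n\ge k}{n \brace k}_{\lambda}\frac{t^n}{n!}$. *)

theory Defs
  imports "HOL-Probability.Probability" "HOL-Computational_Algebra.Formal_Power_Series"
begin

text \<open>All generating functions are formal power series in the variable \<open>t\<close> over the reals.\<close>

definition deg_ffact :: "real \<Rightarrow> real \<Rightarrow> nat \<Rightarrow> real" where
  "deg_ffact lam x n = (\<Prod>i<n. x - real i * lam)"

definition deg_exp :: "real \<Rightarrow> real \<Rightarrow> real fps" where
  "deg_exp lam x = Abs_fps (\<lambda>n. deg_ffact lam x n / fact n)"

text \<open>The closed form \<open>(1 + lam * t) powr (x/lam)\<close> of the degenerate exponential, as a binomial series.\<close>

lemma deg_exp_eq_binomial_series: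
  assumes "lam \<noteq> 0"
  shows "deg_exp lam x = fps_compose (fps_binomial (x / lam)) (fps_const lam * fps_X)"
proof (rule fps_ext)
  fix n
  have "deg_ffact lam x n = (\<Prod>i<n. lam * (x / lam - real i))"
    unfolding deg_ffact_def using assms by (intro prod.cong) (auto simp: field_simps)
  also have "\<dots> = lam ^ n * (\<Prod>i<n. x / lam - real i)"
    by (simp add: prod.distrib)
  finally show "fps_nth (deg_exp lam x) n
      = fps_nth (fps_compose (fps_binomial (x / lam)) (fps_const lam * fps_X)) n"
    by (simp add: deg_exp_def fps_compose_linear fps_binomial_nth gbinomial_prod_rev
        atLeast0LessThan)
qed

definition deg_Ei :: "int \<Rightarrow> real \<Rightarrow> real fps" where
  "deg_Ei k lam = Abs_fps (\<lambda>n. if n = 0 then 0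
     else deg_ffact lam 1 n / (fact (n - 1) * (real n powi k)))"

text \<open>The series \<open>E[e_lam^Y(t)]\<close>: the expectation of the random power series \<open>deg_exp lam (Y \<omega>)\<close>,
  taken coefficient by coefficient.\<close>

definition expect_deg_exp :: "'a measure \<Rightarrow> ('a \<Rightarrow> real) \<Rightarrow> real \<Rightarrow> real fps" where
  "expect_deg_exp M Y lam = Abs_fps (\<lambda>n. \<integral>\<omega>. fps_nth (deg_exp lam (Y \<omega>)) n \<partial>M)"

text \<open>On a probability space the inner series of the composition has constant term \<open>0\<close>.\<close>

definition prob_deg_poly_bell ::
    "'a measure \<Rightarrow> ('a \<Rightarrow> real) \<Rightarrow> int \<Rightarrow> real \<Rightarrow> nat \<Rightarrow> real \<Rightarrow> real" where
  "prob_deg_poly_bell M Y k lam n x =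
     (if n = 0 then 1
      else fact n * fps_nth
        (fps_compose (deg_Ei k lam) (fps_const x * (expect_deg_exp M Y lam - 1))) n)"

definition prob_deg_poly_bell_number ::
    "'a measure \<Rightarrow> ('a \<Rightarrow> real) \<Rightarrow> int \<Rightarrow> real \<Rightarrow> nat \<Rightarrow> real" where
  "prob_deg_poly_bell_number M Y k lam n = prob_deg_poly_bell M Y k lam n 1"

definition deg_stirling2 :: "real \<Rightarrow> nat \<Rightarrow> nat \<Rightarrow> real" where
  "deg_stirling2 lam n m =
     fact n * fps_nth (fps_const (1 / fact m) * (deg_exp lam 1 - 1) ^ m) n"

text \<open>\<^const>\<open>bernoulli_pmf\<close> is a distribution on the Booleans; \<^const>\<open>of_bool\<close> transports it to the
  real values \<open>0\<close> and \<open>1\<close>. The bounds on \<open>p\<close> are needed because \<^const>\<open>bernoulli_pmf\<close> clamps its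
  parameter to the unit interval.\<close>

definition bernoulli_rv :: "'a measure \<Rightarrow> real \<Rightarrow> ('a \<Rightarrow> real) \<Rightarrow> bool" where
  "bernoulli_rv M p Y \<longleftrightarrow> 0 \<le> p \<and> p \<le> 1 \<and> Y \<in> borel_measurable M \<and>
     distr M borel Y = distr (measure_pmf (bernoulli_pmf p)) borel of_bool"

end

theory Submission
  imports Defs
begin

text \<open>For a Bernoulli variable, \<open>E[e_lam^Y(t)] - 1 = p (e_lam(t) - 1)\<close>. Substituting a multiple
  \<open>c (e_lam(t) - 1)\<close> into a power series \<open>\<Sum>m. a m * t^m / m!\<close> turns its coefficients \<open>a m\<close> into
  their degenerate Stirling transform \<open>\<Sum>m. a m * c^m * S(n, m)\<close>, and for the polyexponential
  series \<open>a m\<close> is \<open>deg_ffact lam 1 m / m powi (k - 1)\<close> for \<open>m > 0\<close> and \<open>a 0 = 0\<close>.\<close>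

lemma fps_compose_const_mult_nth:
  fixes f g :: "'a::comm_semiring_1 fps"
  shows "fps_nth (f oo (fps_const c * g)) n = (\<Sum>m=0..n. fps_nth f m * c ^ m * fps_nth (g ^ m) n)"
  by (simp add: fps_compose_nth power_mult_distrib mult.assoc)

lemma bernoulli_rv_expectation:
  fixes g :: "real \<Rightarrow> 'b::{banach, second_countable_topology}"
  assumes Y: "bernoulli_rv M p Y" and g: "g \<in> borel_measurable borel"
  shows "(\<integral>\<omega>. g (Y \<omega>) \<partial>M) = p *\<^sub>R g 1 + (1 - p) *\<^sub>R g 0"
proof -
  have p: "0 \<le> p" "p \<le> 1" and Y_measurable: "Y \<in> borel_measurable M"
    and Y_distr: "distr M borel Y = distr (measure_pmf (bernoulli_pmf p)) borel of_bool"
    using Y by (auto simp: bernoulli_rv_def)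
  have "(\<integral>\<omega>. g (Y \<omega>) \<partial>M) = (\<integral>y. g y \<partial>distr M borel Y)"
    by (rule integral_distr[OF Y_measurable g, symmetric])
  also have "\<dots> = (\<integral>b. g (of_bool b) \<partial>measure_pmf (bernoulli_pmf p))"
    unfolding Y_distr by (rule integral_distr) (use g in auto)
  also have "\<dots> = p *\<^sub>R g 1 + (1 - p) *\<^sub>R g 0"
    using p by (subst integral_measure_pmf[of UNIV]) (auto simp: UNIV_bool)
  finally show ?thesis .
qed

lemma deg_exp_0: "deg_exp lam 0 = 1"
proof (rule fps_ext)
  fix n
  have "deg_ffact lam 0 n = (if n = 0 then 1 else 0)"
    by (auto simp: deg_ffact_def)
  then show "fps_nth (deg_exp lam 0) n = fps_nth 1 n"
    by (simp add: deg_exp_def)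
qed

lemma borel_measurable_deg_exp_nth: "(\<lambda>y. fps_nth (deg_exp lam y) n) \<in> borel_measurable borel"
  by (simp add: deg_exp_def deg_ffact_def)

lemma expect_deg_exp_bernoulli:
  assumes "bernoulli_rv M p Y"
  shows "expect_deg_exp M Y lam - 1 = fps_const p * (deg_exp lam 1 - 1)"
proof (rule fps_ext)
  fix n
  have "fps_nth (expect_deg_exp M Y lam) n
      = p * fps_nth (deg_exp lam 1) n + (1 - p) * fps_nth 1 n"
    using bernoulli_rv_expectation[OF assms borel_measurable_deg_exp_nth]
    by (simp add: expect_deg_exp_def deg_exp_0)
  then show "fps_nth (expect_deg_exp M Y lam - 1) n
      = fps_nth (fps_const p * (deg_exp lam 1 - 1)) n"
    by (simp add: algebra_simps split: if_splits)
qed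

lemma fact_mult_deg_exp_minus_1_power_nth:
  "fact n * fps_nth ((deg_exp lam 1 - 1) ^ m) n = fact m * deg_stirling2 lam n m"
  by (simp add: deg_stirling2_def)

lemma fact_mult_compose_deg_exp_minus_1_nth:
  "fact n * fps_nth (f oo (fps_const c * (deg_exp lam 1 - 1))) n
    = (\<Sum>m=0..n. (fact m * fps_nth f m) * c ^ m * deg_stirling2 lam n m)"
proof -
  have "fact n * fps_nth (f oo (fps_const c * (deg_exp lam 1 - 1))) n
      = (\<Sum>m=0..n. fps_nth f m * c ^ m * (fact n * fps_nth ((deg_exp lam 1 - 1) ^ m) n))"
    by (simp add: fps_compose_const_mult_nth sum_distrib_left mult_ac)
  then show ?thesis
    by (simp add: fact_mult_deg_exp_minus_1_power_nth mult_ac)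
qed

lemma deg_Ei_nth_0: "fps_nth (deg_Ei k lam) 0 = 0"
  by (simp add: deg_Ei_def)

lemma fact_mult_deg_Ei_nth:
  assumes "m > 0"
  shows "fact m * fps_nth (deg_Ei k lam) m = deg_ffact lam 1 m / (real m powi (k - 1))"
proof -
  have "fact m = real m * fact (m - 1)"
    using assms by (rule fact_reduce)
  moreover have "real m powi k = real m * real m powi (k - 1)"
    using assms by (simp add: power_int_diff)
  ultimately show ?thesis
    using assms by (simp add: deg_Ei_def)
qed

lemma fact_mult_deg_Ei_compose_deg_exp_minus_1_nth:
  "fact n * fps_nth (deg_Ei k lam oo (fps_const c * (deg_exp lam 1 - 1))) n
    = (\<Sum>m=1..n. deg_ffact lam 1 m / (real m powi (k - 1)) * c ^ m * deg_stirling2 lam n m)"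
  by (simp add: fact_mult_compose_deg_exp_minus_1_nth sum.atLeast_Suc_atMost deg_Ei_nth_0
      fact_mult_deg_Ei_nth)

theorem theorem2p6:
  fixes M :: "'a measure" and Y :: "'a \<Rightarrow> real" and p lam x :: real and k :: int and n :: nat
  assumes "prob_space M"
    and "bernoulli_rv M p Y"
    and "lam \<noteq> 0"
    and "n \<ge> 1"
  shows "prob_deg_poly_bell M Y k lam n x =
           (\<Sum>m=1..n. deg_ffact lam 1 m / (real m powi (k - 1)) * p ^ m * deg_stirling2 lam n m * x ^ m)
       \<and> prob_deg_poly_bell_number M Y k lam n =
           (\<Sum>m=1..n. deg_ffact lam 1 m / (real m powi (k - 1)) * p ^ m * deg_stirling2 lam n m)"
proof -
  have bell: "prob_deg_poly_bell M Y k lam n y =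
      (\<Sum>m=1..n. deg_ffact lam 1 m / (real m powi (k - 1)) * p ^ m * deg_stirling2 lam n m * y ^ m)"
    for y
  proof -
    have "fps_const y * (expect_deg_exp M Y lam - 1) = fps_const (p * y) * (deg_exp lam 1 - 1)"
      by (simp add: expect_deg_exp_bernoulli[OF assms(2)] mult.commute flip: mult.assoc)
    then have "prob_deg_poly_bell M Y k lam n y =
        fact n * fps_nth (deg_Ei k lam oo (fps_const (p * y) * (deg_exp lam 1 - 1))) n"
      using assms(4) by (simp add: prob_deg_poly_bell_def)
    then show ?thesis
      by (simp add: fact_mult_deg_Ei_compose_deg_exp_minus_1_nth power_mult_distrib mult_ac)
  qed
  show ?thesis
    using bell[of x] bell[of 1] by (simp add: prob_deg_poly_bell_number_def)
qed

end
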